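(* Let $R$ be a two-sided Ore domain and $M$ a nonzero divisible left $R$-module. If $M$ has a maximal proper pp subgroup, then $M$ is pp-simple and torsionfree. Conversely, if $M$ is torsionfree, then $M$ is pp-simple (hence has a unique maximal proper pp subgroup).
   Context: A domain is an associative ring with $1$, not necessarily commutative, without zero divisors; it is two-sided Ore if any two nonzero left ideals intersect nontrivially and any two nonzero right ideals intersect nontrivially. Over a domain $R$, a left module $M$ is divisible if $rM=M$ for every nonzero $r\in R$, and torsionfree if $sa=0$ with $s\in R$, $s\ne0$, $a\in M$ implies $a=0$. A pp subgroup of $M$ is a subgroup of the form $\phi(M)=\{a\in M:\exists\bar c\ \text{in } M,\ A\bar c=\mathbf ba\}$ with $A$ an $n\times m$ matrix and $\mathbf b$ a column of length $n$ over $R$. $M$ is pp-simple if it has no proper pp subgroups other than $0$. *)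

theory Defs
  imports Main
begin

(* The library's locale module requires a commutative scalar ring. *)
locale left_module =
  fixes scale :: "'r::ring_1 \<Rightarrow> 'm::ab_group_add \<Rightarrow> 'm"
  assumes scale_right_distrib: "scale r (x + y) = scale r x + scale r y"
    and scale_left_distrib: "scale (r + s) x = scale r x + scale s x"
    and scale_scale: "scale r (scale s x) = scale (r * s) x"
    and scale_one: "scale 1 x = x"

definition left_ideal :: "'r::ring_1 set \<Rightarrow> bool" where
  "left_ideal I \<longleftrightarrow> 0 \<in> I \<and> (\<forall>x\<in>I. \<forall>y\<in>I. x + y \<in> I) \<and> (\<forall>r. \<forall>x\<in>I. r * x \<in> I)"

definition right_ideal :: "'r::ring_1 set \<Rightarrow> bool" where
  "right_ideal I \<longleftrightarrow> 0 \<in> I \<and> (\<forall>x\<in>I. \<forall>y\<in>I. x + y \<in> I) \<and> (\<forall>r. \<forall>x\<in>I. x * r \<in> I)"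

definition two_sided_ore :: "'r::ring_1_no_zero_divisors itself \<Rightarrow> bool" where
  "two_sided_ore _ \<longleftrightarrow>
     (\<forall>I J :: 'r set. left_ideal I \<and> left_ideal J \<and> I \<noteq> {0} \<and> J \<noteq> {0} \<longrightarrow> I \<inter> J \<noteq> {0}) \<and>
     (\<forall>I J :: 'r set. right_ideal I \<and> right_ideal J \<and> I \<noteq> {0} \<and> J \<noteq> {0} \<longrightarrow> I \<inter> J \<noteq> {0})"

definition divisible :: "('r::ring_1_no_zero_divisors \<Rightarrow> 'm::ab_group_add \<Rightarrow> 'm) \<Rightarrow> bool" where
  "divisible scale \<longleftrightarrow> (\<forall>r. r \<noteq> 0 \<longrightarrow> range (scale r) = UNIV)"

definition torsionfree :: "('r::ring_1_no_zero_divisors \<Rightarrow> 'm::ab_group_add \<Rightarrow> 'm) \<Rightarrow> bool" where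
  "torsionfree scale \<longleftrightarrow> (\<forall>s a. s \<noteq> 0 \<and> scale s a = 0 \<longrightarrow> a = 0)"

(* The n x m matrix A and the column b are functions on indices, of which only the
   values with i < n and j < m matter; likewise for the tuple c in M. *)
definition pp_set ::
  "('r::ring_1 \<Rightarrow> 'm::ab_group_add \<Rightarrow> 'm) \<Rightarrow> nat \<Rightarrow> nat \<Rightarrow> (nat \<Rightarrow> nat \<Rightarrow> 'r) \<Rightarrow> (nat \<Rightarrow> 'r) \<Rightarrow> 'm set"
where
  "pp_set scale n m A b =
     {a. \<exists>c :: nat \<Rightarrow> 'm. \<forall>i<n. (\<Sum>j<m. scale (A i j) (c j)) = scale (b i) a}"

definition pp_subgroup :: "('r::ring_1 \<Rightarrow> 'm::ab_group_add \<Rightarrow> 'm) \<Rightarrow> 'm set \<Rightarrow> bool" where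
  "pp_subgroup scale N \<longleftrightarrow> (\<exists>n m A b. N = pp_set scale n m A b)"

(* Being an additive subgroup is automatic, hence not part of the definition. *)
lemma (in left_module) pp_subgroup_is_subgroup:
  assumes "pp_subgroup scale N"
  shows "0 \<in> N" and "x \<in> N \<Longrightarrow> y \<in> N \<Longrightarrow> x - y \<in> N"
proof -
  have zero: "scale r 0 = 0" for r
    using scale_right_distrib[of r 0 0] by simp
  have diff: "scale r (u - v) = scale r u - scale r v" for r u v
    using scale_right_distrib[of r "u - v" v] by (simp add: algebra_simps)
  obtain n m A b where N: "N = pp_set scale n m A b"
    using assms unfolding pp_subgroup_def by blast
  show "0 \<in> N"
    unfolding N pp_set_def by (auto simp: zero intro!: exI[of _ "\<lambda>_. 0"])
  assume "x \<in> N" "y \<in> N"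
  then obtain c d where
    "\<forall>i<n. (\<Sum>j<m. scale (A i j) (c j)) = scale (b i) x"
    "\<forall>i<n. (\<Sum>j<m. scale (A i j) (d j)) = scale (b i) y"
    unfolding N pp_set_def by blast
  then have "\<forall>i<n. (\<Sum>j<m. scale (A i j) (c j - d j)) = scale (b i) (x - y)"
    by (simp add: diff sum_subtractf)
  then show "x - y \<in> N"
    unfolding N pp_set_def by (intro CollectI exI[of _ "\<lambda>j. c j - d j"])
qed

definition pp_simple :: "('r::ring_1 \<Rightarrow> 'm::ab_group_add \<Rightarrow> 'm) \<Rightarrow> bool" where
  "pp_simple scale \<longleftrightarrow> (\<forall>N. pp_subgroup scale N \<and> N \<noteq> UNIV \<longrightarrow> N = {0})"

definition maximal_proper_pp_subgroup ::
  "('r::ring_1 \<Rightarrow> 'm::ab_group_add \<Rightarrow> 'm) \<Rightarrow> 'm set \<Rightarrow> bool"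
where
  "maximal_proper_pp_subgroup scale N \<longleftrightarrow>
     pp_subgroup scale N \<and> N \<noteq> UNIV \<and>
     (\<forall>P. pp_subgroup scale P \<and> P \<noteq> UNIV \<and> N \<subseteq> P \<longrightarrow> P = N)"

end

theory Submission
  imports Defs
begin

text \<open>
  Gaussian elimination, with the Ore conditions in place of division, shows that for a system
  \<open>A c = b a\<close> either the ring itself contains a solution \<open>A c = b s\<close> with \<open>s \<noteq> 0\<close>, or eliminating
  all unknowns leaves a condition \<open>r a = 0\<close> with \<open>r \<noteq> 0\<close>. In a divisible module the first
  alternative makes the pp subgroup contain \<open>s M = M\<close>. So every proper pp subgroup is contained in
  some annihilator \<open>ann r = {a. r a = 0}\<close> with \<open>r \<noteq> 0\<close>, and these are themselves proper pp
  subgroups, directed upwards by the left Ore condition. A maximal proper pp subgroup is therefore the largest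
  annihilator \<open>ann r\<close>; since it contains \<open>ann (r r)\<close>, divisibility by \<open>r\<close> forces it to be \<open>0\<close>.
\<close>

section \<open>Ore conditions for pairs of elements\<close>

text \<open>For \<open>x\<close> nonzero, the principal left ideals of \<open>x\<close> and
  \<open>y\<close> share some \<open>w = s * x = t * y\<close> with \<open>w\<close> nonzero, and
  then \<open>s\<close> cannot vanish. This replaces division when a pivot \<open>y\<close> is to
  clear another entry \<open>x\<close> of its column.\<close>

lemma left_ore:
  fixes x y :: "'r::ring_1_no_zero_divisors"
  assumes "two_sided_ore TYPE('r)" "y \<noteq> 0"
  obtains s t where "s \<noteq> 0" "s * x = t * y"
proof (cases "x = 0")
  case True
  then show ?thesis using that[of 1 0] by simp
next
  case False
  define I where "I z = range (\<lambda>r. r * z)" for z :: 'r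
  have zero: "0 \<in> I z" for z
    unfolding I_def by (rule range_eqI[of _ _ 0]) simp
  have ideal: "left_ideal (I z)" for z
    unfolding left_ideal_def
  proof (intro conjI ballI allI)
    fix r u v assume "u \<in> I z" "v \<in> I z"
    then obtain p q where uv: "u = p * z" "v = q * z" unfolding I_def by (elim rangeE)
    show "u + v \<in> I z"
      unfolding I_def uv by (rule range_eqI[of _ _ "p + q"]) (simp add: distrib_right)
    show "r * u \<in> I z"
      unfolding I_def uv by (rule range_eqI[of _ _ "r * p"]) (simp add: mult.assoc)
  qed (rule zero)
  have nonzero: "I z \<noteq> {0}" if "z \<noteq> 0" for z
  proof
    have "1 * z \<in> I z" unfolding I_def by (rule rangeI)
    moreover assume "I z = {0}"
    ultimately show False using that by simp
  qed
  have "I x \<inter> I y \<noteq> {0}"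
    using assms(1) ideal nonzero[OF False] nonzero[OF assms(2)] unfolding two_sided_ore_def by simp
  moreover have "0 \<in> I x \<inter> I y" using zero by simp
  ultimately obtain w where "w \<noteq> 0" "w \<in> I x" "w \<in> I y" by auto
  then obtain s t where "w = s * x" "w = t * y" unfolding I_def by (elim rangeE)
  with \<open>w \<noteq> 0\<close> show ?thesis using that[of s t] by auto
qed

text \<open>The mirror argument with principal right ideals. It solves a pivot equation, whose
  unknown stands to the right of its coefficient \<open>y\<close>, up to a right factor
  \<open>s\<close>.\<close>

lemma right_ore:
  fixes x y :: "'r::ring_1_no_zero_divisors"
  assumes "two_sided_ore TYPE('r)" "y \<noteq> 0"
  obtains s t where "s \<noteq> 0" "x * s = y * t"
proof (cases "x = 0")
  case True
  then show ?thesis using that[of 1 0] by simp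
next
  case False
  define I where "I z = range (\<lambda>r. z * r)" for z :: 'r
  have zero: "0 \<in> I z" for z
    unfolding I_def by (rule range_eqI[of _ _ 0]) simp
  have ideal: "right_ideal (I z)" for z
    unfolding right_ideal_def
  proof (intro conjI ballI allI)
    fix r u v assume "u \<in> I z" "v \<in> I z"
    then obtain p q where uv: "u = z * p" "v = z * q" unfolding I_def by (elim rangeE)
    show "u + v \<in> I z"
      unfolding I_def uv by (rule range_eqI[of _ _ "p + q"]) (simp add: distrib_left)
    show "u * r \<in> I z"
      unfolding I_def uv by (rule range_eqI[of _ _ "p * r"]) (simp add: mult.assoc)
  qed (rule zero)
  have nonzero: "I z \<noteq> {0}" if "z \<noteq> 0" for z
  proof
    have "z * 1 \<in> I z" unfolding I_def by (rule rangeI)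
    moreover assume "I z = {0}"
    ultimately show False using that by simp
  qed
  have "I x \<inter> I y \<noteq> {0}"
    using assms(1) ideal nonzero[OF False] nonzero[OF assms(2)] unfolding two_sided_ore_def by simp
  moreover have "0 \<in> I x \<inter> I y" using zero by simp
  ultimately obtain w where "w \<noteq> 0" "w \<in> I x" "w \<in> I y" by auto
  then obtain s t where "w = x * s" "w = y * t" unfolding I_def by (elim rangeE)
  with \<open>w \<noteq> 0\<close> show ?thesis using that[of s t] by auto
qed

section \<open>Scalar arithmetic and annihilators in a left module\<close>

context left_module
begin

lemma scale_zero_right: "scale r 0 = 0"
  using scale_right_distrib[of r 0 0] by simp

lemma scale_zero_left: "scale 0 x = 0"
  using scale_left_distrib[of 0 0 x] by simp

lemma scale_diff_left: "scale (r - s) x = scale r x - scale s x"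
  using scale_left_distrib[of "r - s" s x] by (simp add: algebra_simps)

lemma scale_sum_right: "scale r (\<Sum>j\<in>J. f j) = (\<Sum>j\<in>J. scale r (f j))"
  by (induction J rule: infinite_finite_induct) (simp_all add: scale_zero_right scale_right_distrib)

lemma scale_sum_left: "scale (\<Sum>j\<in>J. f j) x = (\<Sum>j\<in>J. scale (f j) x)"
  by (induction J rule: infinite_finite_induct) (simp_all add: scale_zero_left scale_left_distrib)

lemma pp_subgroup_annihilator: "pp_subgroup scale {a. scale r a = 0}"
proof -
  \<comment> \<open>One equation in no unknowns: the empty sum equals
    \<open>scale r a\<close>.\<close>
  have "{a. scale r a = 0} = pp_set scale 1 0 (\<lambda>_ _. 0) (\<lambda>_. r)"
    by (simp add: pp_set_def eq_commute[of 0])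
  then show ?thesis unfolding pp_subgroup_def by (intro exI)
qed

end

section \<open>Elimination over an Ore domain\<close>

text \<open>Induction on the number of unknowns: the left Ore condition eliminates the last unknown
  from the system, and the right Ore condition recovers its value by back substitution in the
  ring.\<close>

lemma pp_set_annihilated_or_solvable:
  fixes scale :: "'r::ring_1_no_zero_divisors \<Rightarrow> 'm::ab_group_add \<Rightarrow> 'm"
  assumes ore: "two_sided_ore TYPE('r)" and module: "left_module scale"
  shows "(\<exists>r. r \<noteq> 0 \<and> pp_set scale n m A b \<subseteq> {a. scale r a = 0}) \<or>
         (\<exists>c s. s \<noteq> 0 \<and> (\<forall>i<n. (\<Sum>j<m. A i j * c j) = b i * s))"
proof -
  interpret left_module scale by (fact module)
  show ?thesis
  proof (induction m arbitrary: A b)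
    case 0
    show ?case
    proof (cases "\<forall>i<n. b i = 0")
      case True
      then have "\<forall>i<n. (\<Sum>j<0. A i j * 0) = b i * 1" by simp
      then show ?thesis by (intro disjI2 exI[of _ "\<lambda>_. 0"] exI[of _ 1]) simp
    next
      case False
      then obtain i where "i < n" "b i \<noteq> 0" by blast
      then show ?thesis unfolding pp_set_def by (force intro: disjI1)
    qed
  next
    case (Suc m)
    show ?case
    proof (cases "\<forall>i<n. A i m = 0")
      case True
      then have "pp_set scale n (Suc m) A b = pp_set scale n m A b"
        by (simp add: pp_set_def scale_zero_left)
      moreover have "(\<Sum>j<Suc m. A i j * c j) = (\<Sum>j<m. A i j * c j)" if "i < n" for i c
        using True that by simp
      ultimately show ?thesis using Suc.IH[of A b] by metis
    next
      case False
      then obtain p where p: "p < n" "A p m \<noteq> 0" by blast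
      have "\<exists>s t. s \<noteq> 0 \<and> s * A i m = t * A p m" for i
        using left_ore[OF ore p(2)] by metis
      then obtain s t where s: "\<And>i. s i \<noteq> 0" and st: "\<And>i. s i * A i m = t i * A p m"
        by metis
      \<comment> \<open>By \<open>st\<close> the new rows have entry 0 in column \<open>m\<close>.
        The pivot row turns into a zero row, because \<open>s p = t p\<close> after cancelling
        \<open>A p m\<close>, so \<open>n\<close> stays the same.\<close>
      define A' where "A' i j = s i * A i j - t i * A p j" for i j
      define b' where "b' i = s i * b i - t i * b p" for i
      \<comment> \<open>The new system follows from the old one but may be weaker. Annihilation by
        \<open>r\<close> passes to subsets, so the inclusion suffices.\<close>
      have sub: "pp_set scale n (Suc m) A b \<subseteq> pp_set scale n m A' b'"
      proof
        fix a assume "a \<in> pp_set scale n (Suc m) A b"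
        then obtain c where c: "\<And>i. i < n \<Longrightarrow> (\<Sum>j<Suc m. scale (A i j) (c j)) = scale (b i) a"
          unfolding pp_set_def by blast
        have "(\<Sum>j<m. scale (A' i j) (c j)) = scale (b' i) a" if "i < n" for i
        proof -
          have "(\<Sum>j<m. scale (A' i j) (c j)) = (\<Sum>j<Suc m. scale (A' i j) (c j))"
            by (simp add: A'_def st scale_zero_left)
          also have "\<dots> = scale (s i) (\<Sum>j<Suc m. scale (A i j) (c j))
                          - scale (t i) (\<Sum>j<Suc m. scale (A p j) (c j))"
            unfolding scale_sum_right A'_def sum_subtractf[symmetric]
            by (simp only: scale_diff_left scale_scale)
          also have "\<dots> = scale (b' i) a"
            unfolding c[OF that] c[OF p(1)] b'_def by (simp only: scale_diff_left scale_scale)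
          finally show ?thesis .
        qed
        then show "a \<in> pp_set scale n m A' b'" unfolding pp_set_def by blast
      qed
      from Suc.IH[of A' b'] show ?thesis
      proof (elim disjE exE conjE)
        fix r assume "r \<noteq> 0" "pp_set scale n m A' b' \<subseteq> {a. scale r a = 0}"
        then show ?thesis using sub by blast
      next
        fix c d assume d: "d \<noteq> 0" and c: "\<forall>i<n. (\<Sum>j<m. A' i j * c j) = b' i * d"
        \<comment> \<open>The residual of row \<open>i\<close>, which the term of the last unknown
          has to supply. Solving the pivot row for it costs a right factor \<open>q\<close>, by
          which the whole solution is then multiplied.\<close>
        define R where "R i = b i * d - (\<Sum>j<m. A i j * c j)" for i
        obtain q y where q: "q \<noteq> 0" "R p * q = A p m * y"
          using right_ore[OF ore p(2)] by metis
        define e where "e j = (if j < m then c j * q else y)" for j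
        have e: "(\<Sum>j<Suc m. A i j * e j) = (\<Sum>j<m. A i j * c j) * q + A i m * y" for i
          by (simp add: e_def sum_distrib_right mult.assoc)
        have "(\<Sum>j<Suc m. A i j * e j) = b i * (d * q)" if "i < n" for i
        proof -
          \<comment> \<open>Solvability of the reduced system makes every residual proportional to
            that of the pivot row, so \<open>y\<close> fits all rows once \<open>s i\<close> is
            cancelled.\<close>
          have "s i * R i - t i * R p = b' i * d - (\<Sum>j<m. A' i j * c j)"
            unfolding R_def A'_def b'_def
            by (simp add: algebra_simps sum_distrib_left sum_subtractf)
          then have "s i * R i = t i * R p" using c that by simp
          then have "s i * (R i * q) = t i * (R p * q)" by (simp flip: mult.assoc)
          also have "\<dots> = s i * (A i m * y)" unfolding q(2) by (simp add: st flip: mult.assoc)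
          finally have "R i * q = A i m * y" using s by simp
          then show ?thesis unfolding e R_def by (simp add: algebra_simps)
        qed
        moreover have "d * q \<noteq> 0" using d q(1) by simp
        ultimately show ?thesis by blast
      qed
    qed
  qed
qed

section \<open>Proper pp subgroups of divisible modules\<close>

lemma divisibleE:
  assumes "divisible scale" "r \<noteq> 0"
  obtains x where "a = scale r x"
proof -
  have "a \<in> range (scale r)" using assms by (simp add: divisible_def)
  then show ?thesis using that by (elim rangeE)
qed

lemma proper_pp_subgroup_annihilated:
  fixes scale :: "'r::ring_1_no_zero_divisors \<Rightarrow> 'm::ab_group_add \<Rightarrow> 'm"
  assumes ore: "two_sided_ore TYPE('r)" and module: "left_module scale"
    and div: "divisible scale" and N: "pp_subgroup scale N" "N \<noteq> UNIV"
  obtains r where "r \<noteq> 0" "N \<subseteq> {a. scale r a = 0}"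
proof -
  interpret left_module scale by (fact module)
  obtain n m A b where eq: "N = pp_set scale n m A b"
    using N(1) unfolding pp_subgroup_def by blast
  have False if "s \<noteq> 0" and c: "\<forall>i<n. (\<Sum>j<m. A i j * c j) = b i * s" for c s
  proof -
    have "a \<in> N" for a
    proof -
      \<comment> \<open>Acting on \<open>x\<close> turns the ring solution \<open>c\<close> for
        \<open>s\<close> into a solution in the module for \<open>scale s x\<close>, which is an
        arbitrary element by divisibility.\<close>
      obtain x where x: "a = scale s x" using divisibleE[OF div \<open>s \<noteq> 0\<close>] .
      have "(\<Sum>j<m. scale (A i j) (scale (c j) x)) = scale (b i) a" if "i < n" for i
      proof -
        have "(\<Sum>j<m. scale (A i j) (scale (c j) x)) = scale (\<Sum>j<m. A i j * c j) x"
          by (simp only: scale_scale scale_sum_left)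
        then show ?thesis using c that by (simp add: x scale_scale)
      qed
      then show ?thesis
        unfolding eq pp_set_def by (intro CollectI exI[of _ "\<lambda>j. scale (c j) x"]) blast
    qed
    then show False using N(2) by blast
  qed
  then have "\<exists>r. r \<noteq> 0 \<and> N \<subseteq> {a. scale r a = 0}"
    using pp_set_annihilated_or_solvable[OF ore module, of n m A b] unfolding eq by meson
  then show ?thesis using that by (elim exE conjE)
qed

lemma torsionfree_imp_pp_simple:
  fixes scale :: "'r::ring_1_no_zero_divisors \<Rightarrow> 'm::ab_group_add \<Rightarrow> 'm"
  assumes "two_sided_ore TYPE('r)" "left_module scale" "divisible scale" "torsionfree scale"
  shows "pp_simple scale"
proof -
  have "N = {0}" if N: "pp_subgroup scale N" "N \<noteq> UNIV" for N
  proof -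
    obtain r where r: "r \<noteq> 0" "N \<subseteq> {a. scale r a = 0}"
      using proper_pp_subgroup_annihilated[OF assms(1-3) N] .
    have "a = 0" if "a \<in> N" for a
    proof -
      have "scale r a = 0" using subsetD[OF r(2) that] by simp
      then show ?thesis using assms(4) r(1) by (simp add: torsionfree_def)
    qed
    moreover have "0 \<in> N"
      using left_module.pp_subgroup_is_subgroup(1)[OF assms(2) N(1)] .
    ultimately show ?thesis by (intro equalityI subsetI) simp_all
  qed
  then show ?thesis unfolding pp_simple_def by simp
qed

lemma maximal_proper_pp_subgroup_imp_torsionfree:
  fixes scale :: "'r::ring_1_no_zero_divisors \<Rightarrow> 'm::ab_group_add \<Rightarrow> 'm"
  assumes ore: "two_sided_ore TYPE('r)" and module: "left_module scale"
    and nonzero: "\<exists>x::'m. x \<noteq> 0" and div: "divisible scale"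
    and max: "maximal_proper_pp_subgroup scale N"
  shows "torsionfree scale"
proof -
  interpret left_module scale by (fact module)
  have N: "pp_subgroup scale N" "N \<noteq> UNIV"
    and N_max: "\<And>P. pp_subgroup scale P \<Longrightarrow> P \<noteq> UNIV \<Longrightarrow> N \<subseteq> P \<Longrightarrow> P = N"
    using max by (simp_all add: maximal_proper_pp_subgroup_def)
  have proper: "{a. scale r a = 0} \<noteq> UNIV" if "r \<noteq> 0" for r
  proof
    assume "{a. scale r a = 0} = UNIV"
    then have zero: "scale r a = 0" for a by (simp add: set_eq_iff)
    obtain x :: 'm where "x \<noteq> 0" using nonzero by (elim exE)
    moreover obtain y where "x = scale r y" using divisibleE[OF div \<open>r \<noteq> 0\<close>] .
    ultimately show False using zero by simp
  qed
  have maximal: "{a. scale r a = 0} = N" if "r \<noteq> 0" "N \<subseteq> {a. scale r a = 0}" for r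
    using N_max[OF pp_subgroup_annihilator proper] that .
  obtain r where r: "r \<noteq> 0" "N \<subseteq> {a. scale r a = 0}"
    using proper_pp_subgroup_annihilated[OF ore module div N] .
  have largest: "scale r a = 0" if "s \<noteq> 0" "scale s a = 0" for s a
  proof -
    \<comment> \<open>The annihilator of the common left multiple contains both \<open>N\<close> and
      the annihilator of \<open>s\<close>; maximality makes it equal to \<open>N\<close>.\<close>
    obtain u v where uv: "u \<noteq> 0" "u * r = v * s" using left_ore[OF ore \<open>s \<noteq> 0\<close>] by metis
    have "N \<subseteq> {a. scale (u * r) a = 0}"
      using r(2) by (auto simp: scale_zero_right simp flip: scale_scale)
    then have "{a. scale (u * r) a = 0} = N" using uv(1) r(1) by (intro maximal) simp_all
    moreover have "scale (u * r) a = 0"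
      unfolding uv(2) using that(2) by (simp add: scale_zero_right flip: scale_scale)
    ultimately show ?thesis using r(2) by blast
  qed
  have "a = 0" if "s \<noteq> 0" "scale s a = 0" for s a
  proof -
    \<comment> \<open>Since \<open>r\<close> kills \<open>a\<close>, the nonzero element
      \<open>r * r\<close> kills \<open>x\<close>; hence \<open>r\<close> already kills
      \<open>x\<close>, which says \<open>a = 0\<close>.\<close>
    obtain x where x: "a = scale r x" using divisibleE[OF div r(1)] .
    have "scale (r * r) x = 0" using largest[OF that] by (simp add: x scale_scale)
    then show ?thesis using largest[of "r * r" x] r(1) x by simp
  qed
  then show ?thesis unfolding torsionfree_def by blast
qed

theorem corollary4p25:
  fixes scale :: "'r::ring_1_no_zero_divisors \<Rightarrow> 'm::ab_group_add \<Rightarrow> 'm"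
  assumes "two_sided_ore TYPE('r)"
    and "left_module scale"
    and "\<exists>x::'m. x \<noteq> 0"
    and "divisible scale"
  shows "((\<exists>N. maximal_proper_pp_subgroup scale N) \<longrightarrow> pp_simple scale \<and> torsionfree scale) \<and>
         (torsionfree scale \<longrightarrow>
            pp_simple scale \<and> (\<exists>!N. maximal_proper_pp_subgroup scale N))"
proof -
  have simple: "torsionfree scale \<Longrightarrow> pp_simple scale"
    using torsionfree_imp_pp_simple assms by blast
  have "\<exists>!N. maximal_proper_pp_subgroup scale N" if "pp_simple scale"
  proof (rule ex1I)
    \<comment> \<open>The zero subgroup is the annihilator of 1.\<close>
    have "pp_subgroup scale {0}"
      using left_module.pp_subgroup_annihilator[OF assms(2), of 1]
      by (simp add: left_module.scale_one[OF assms(2)])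
    moreover have "{0} \<noteq> (UNIV :: 'm set)" using assms(3) by blast
    ultimately show "maximal_proper_pp_subgroup scale {0}"
      using that unfolding maximal_proper_pp_subgroup_def pp_simple_def by blast
    show "N = {0}" if "maximal_proper_pp_subgroup scale N" for N
      using \<open>pp_simple scale\<close> that
      unfolding maximal_proper_pp_subgroup_def pp_simple_def by blast
  qed
  then show ?thesis
    using simple maximal_proper_pp_subgroup_imp_torsionfree[OF assms] by blast
qed

end
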